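(* Let $n\ge 1$, $t\ge 1$ and let $\mathbf a\in SST_{2n}(\varpi_t)$ be a column of length $t$. Then $\mathbf a\in SpT_{2n}(\varpi_t)$ (i.e. $\mathbf a$ is symplectic) if and only if, for some $k\ge 0$, $\mathbf a$ can be written as a concatenation $$\mathbf a=X^{(0)}\mathbf A_1X^{(1)}\mathbf A_2\cdots \mathbf A_{k-1}X^{(k-1)}\mathbf A_kX^{(k)},$$ where (1) for $i=0,1,\dots,k$, $X^{(i)}$ is a column word of length $p_i\ge 0$, and $\mathbf s(X^{(0)}X^{(1)}\cdots X^{(k)})\cap \mathbf a=\emptyset$; (2) for $i=1,\dots,k$, $\mathbf A_i=(a_i,a_i+1,\dots,a_i+t_i-1)$ with $a_i$ odd and $t_i\ge 2$ even is a maximal nonempty interval contained in $\mathbf a$ such that $\mathbf s(\mathbf A_i)=\mathbf A_i$; moreover $t=\sum_{i=1}^k t_i+\sum_{i=0}^k p_i\in\{1,\dots,n\}$, and for $i=1,\dots,k$ $$a_i\ge 2t^{(i-1)}+t_i+1,\qquad\text{where } t^{(i-1)}:=\sum_{j=1}^{i-1}t_j+\sum_{j=0}^{i-1}p_j\quad(\text{so } t^{(0)}=p_0).$$ Moreover, this decomposition is unique in the sense that the maximal nonempty intervals $\mathbf A_i$ fixed by $\mathbf s$ are uniquely determined by $\mathbf a$: their union is the part of $\mathbf a$ fixed by $\mathbf s$, i.e. $\{x\in\mathbf a:\mathbf s(x)\in\mathbf a\}$, and what remains is the subword $\mathbf a\setminus\bigsqcup_{i=1}^k\mathbf A_i$,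 which satisfies $\mathbf s(\mathbf a\setminus\bigsqcup_{i=1}^k\mathbf A_i)\cap\mathbf a=\emptyset$.
   Context: $SST_{2n}(\varpi_t)$ is the set of columns of length $t$ on the alphabet $\{1,\dots,2n\}$, i.e. strictly increasing sequences $\mathbf a=(b_1<b_2<\dots<b_t)$ with entries in $\{1,\dots,2n\}$; a column is often identified with the set of its entries, or with the word $b_1b_2\cdots b_t$. A column word is a strictly increasing word (possibly empty). $SpT_{2n}(\varpi_t)$ is the subset of symplectic columns, those with $b_k\ge 2k-1$ for all $k=1,\dots,t$. The parity involution $\mathbf s:\mathbb Z\to\mathbb Z$ is $\mathbf s(x)=x+1$ if $x$ is odd and $\mathbf s(x)=x-1$ if $x$ is even; for a set or word $X$, $\mathbf s(X)=\{\mathbf s(x):x\in X\}$. An interval is a set of consecutive integers. "Maximal nonempty interval fixed by $\mathbf s$" means maximal for inclusion among the nonempty intervals $I\subseteq\mathbf a$ with $\mathbf s(I)=I$. *)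

theory Defs
  imports Main "HOL-Library.Disjoint_Sets"
begin

definition parity_inv :: "int \<Rightarrow> int" where
  "parity_inv x = (if odd x then x + 1 else x - 1)"

definition column_word :: "int list \<Rightarrow> bool" where
  "column_word w \<longleftrightarrow> sorted_wrt (<) w"

definition SST :: "nat \<Rightarrow> nat \<Rightarrow> int list set" where
  "SST n t = {b. column_word b \<and> length b = t \<and> set b \<subseteq> {1..2 * int n}}"

text \<open>The condition on the \<open>k\<close>-th entry is stated for \<open>k\<close> counted from 1; lists are indexed from 0.\<close>

definition SpT :: "nat \<Rightarrow> nat \<Rightarrow> int list set" where
  "SpT n t = {b \<in> SST n t. \<forall>k\<in>{1..t}. b ! (k - 1) \<ge> 2 * int k - 1}"

definition fixed_interval_in :: "int set \<Rightarrow> int set \<Rightarrow> bool" where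
  "fixed_interval_in S I \<longleftrightarrow>
     I \<noteq> {} \<and> (\<exists>l u. I = {l..u}) \<and> I \<subseteq> S \<and> parity_inv ` I = I"

definition maximal_fixed_interval_in :: "int set \<Rightarrow> int set \<Rightarrow> bool" where
  "maximal_fixed_interval_in S I \<longleftrightarrow>
     fixed_interval_in S I \<and> (\<forall>J. fixed_interval_in S J \<and> I \<subseteq> J \<longrightarrow> J = I)"

text \<open>The words of a decomposition are given by families \<open>X\<close> and \<open>A\<close>, of which only
  \<open>X 0, \<dots>, X k\<close> and \<open>A 1, \<dots>, A k\<close> are relevant. \<open>prefix_length X A m\<close> is the length of
  \<open>X 0 @ A 1 @ X 1 @ \<dots> @ A m @ X m\<close>.\<close>

definition prefix_length :: "(nat \<Rightarrow> int list) \<Rightarrow> (nat \<Rightarrow> int list) \<Rightarrow> nat \<Rightarrow> nat" where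
  "prefix_length X A m = (\<Sum>j=1..m. length (A j)) + (\<Sum>j=0..m. length (X j))"

definition symplectic_decomposition ::
  "nat \<Rightarrow> nat \<Rightarrow> int list \<Rightarrow> nat \<Rightarrow> (nat \<Rightarrow> int list) \<Rightarrow> (nat \<Rightarrow> int list) \<Rightarrow> bool" where
  "symplectic_decomposition n t a k X A \<longleftrightarrow>
     a = X 0 @ concat (map (\<lambda>i. A i @ X i) [1..<Suc k]) \<and>
     (\<forall>i\<in>{0..k}. column_word (X i)) \<and>
     parity_inv ` set (concat (map X [0..<Suc k])) \<inter> set a = {} \<and>
     t = prefix_length X A k \<and> t \<in> {1..n} \<and>
     (\<forall>i\<in>{1..k}. \<exists>c l.
        length (A i) = l \<and> odd c \<and> even l \<and> l \<ge> 2 \<and>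
        A i = [c..c + int l - 1] \<and>
        maximal_fixed_interval_in (set a) (set (A i)) \<and>
        c \<ge> 2 * int (prefix_length X A (i - 1)) + int l + 1)"

end

(* A letter of a is paired if its image under s is also in a.  Maximal fixed intervals are
   disjoint and exhaust the paired letters, so cutting a at them gives the decomposition, and
   listing them from left to right gives its uniqueness.

   The last letter c + l - 1 of an interval A_i stands at position T + l with T = t^(i-1), so the
   symplectic condition there reads c >= 2 T + l, which parity sharpens to c >= 2 T + l + 1.
   Conversely this bound implies the symplectic condition on all of A_i, and an unpaired letter
   inherits it from its predecessor: if b_(k-1) = 2k - 3 then b_k cannot be 2k - 2, the partner of
   b_(k-1). *)

theory Submission
  imports Defs
begin

section \<open>Fixed intervals\<close>

lemma parity_inv_parity_inv [simp]: "parity_inv (parity_inv x) = x"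
  by (simp add: parity_inv_def)

lemma fixed_interval_closed:
  assumes "fixed_interval_in S I" "x \<in> I"
  shows "parity_inv x \<in> I"
proof -
  have "parity_inv ` I = I" using assms(1) by (simp add: fixed_interval_in_def)
  then show ?thesis using imageI[OF assms(2), of parity_inv] by simp
qed

text \<open>An even left endpoint \<open>l\<close> would force \<open>l - 1\<close> into the
  interval, and an odd right endpoint \<open>u\<close> would force \<open>u + 1\<close> into it. The
  opposite parities then rule out \<open>l = u\<close>.\<close>

lemma fixed_intervalE:
  assumes "fixed_interval_in S I"
  obtains l u where "I = {l..u}" "l < u" "odd l" "even u"
proof -
  obtain l u where I: "I = {l..u}" "I \<noteq> {}"
    using assms unfolding fixed_interval_in_def by blast
  then have le: "l \<le> u" by auto
  have closed: "parity_inv x \<in> I" if "x \<in> I" for x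
    using fixed_interval_closed[OF assms that] .
  have "odd l" using closed[of l] I le by (auto simp: parity_inv_def split: if_splits)
  moreover have "even u" using closed[of u] I le by (auto simp: parity_inv_def split: if_splits)
  ultimately have "l < u" using le by (cases "l = u") auto
  with I \<open>odd l\<close> \<open>even u\<close> show thesis using that by blast
qed

lemma fixed_interval_paired:
  assumes "fixed_interval_in S I"
  shows "I \<subseteq> {x \<in> S. parity_inv x \<in> S}"
proof -
  have "I \<subseteq> S" using assms by (simp add: fixed_interval_in_def)
  then show ?thesis using fixed_interval_closed[OF assms] by blast
qed

text \<open>Two intersecting integer intervals have an interval as their union. This closure is what
  makes intersecting maximal fixed intervals coincide.\<close>

lemma fixed_interval_Un:
  assumes "fixed_interval_in S I" "fixed_interval_in S J" "I \<inter> J \<noteq> {}"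
  shows "fixed_interval_in S (I \<union> J)"
proof -
  obtain l u where I: "I = {l..u}" using assms(1) unfolding fixed_interval_in_def by blast
  obtain l' u' where J: "J = {l'..u'}" using assms(2) unfolding fixed_interval_in_def by blast
  have "I \<union> J = {min l l'..max u u'}" using assms(3) unfolding I J by auto
  moreover have "parity_inv ` (I \<union> J) = I \<union> J" "I \<union> J \<noteq> {}" "I \<union> J \<subseteq> S"
    using assms(1,2) by (simp_all add: fixed_interval_in_def image_Un)
  ultimately show ?thesis unfolding fixed_interval_in_def by blast
qed

lemma maximal_fixed_interval_unique:
  assumes "maximal_fixed_interval_in S I" "maximal_fixed_interval_in S J" "x \<in> I" "x \<in> J"
  shows "I = J"
proof -
  have "fixed_interval_in S (I \<union> J)"
    using assms fixed_interval_Un unfolding maximal_fixed_interval_in_def by blast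
  then show ?thesis using assms(1,2) unfolding maximal_fixed_interval_in_def by blast
qed

text \<open>The two adjacent letters \<open>x\<close> and \<open>parity_inv x\<close> already form a
  fixed interval, and finiteness of \<open>S\<close> allows it to be enlarged to a maximal
  one.\<close>

lemma paired_in_maximal_fixed_interval:
  assumes "finite S" "x \<in> S" "parity_inv x \<in> S"
  obtains I where "maximal_fixed_interval_in S I" "x \<in> I"
proof -
  define C where "C = {I. fixed_interval_in S I \<and> x \<in> I}"
  have "C \<subseteq> Pow S" unfolding C_def fixed_interval_in_def by blast
  then have "finite C" using assms(1) by (meson finite_Pow_iff finite_subset)
  moreover have "{x, parity_inv x} \<in> C"
  proof -
    have "{x, parity_inv x} = {min x (parity_inv x)..max x (parity_inv x)}"
      by (auto simp: parity_inv_def)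
    then have "\<exists>l u. {x, parity_inv x} = {l..u}" by blast
    moreover have "parity_inv ` {x, parity_inv x} = {x, parity_inv x}" by auto
    ultimately show ?thesis using assms(2,3) by (simp add: C_def fixed_interval_in_def)
  qed
  ultimately obtain I where I: "I \<in> C" "\<forall>J\<in>C. I \<subseteq> J \<longrightarrow> I = J"
    using finite_has_maximal2[of C] by blast
  \<comment> \<open>A fixed interval containing \<open>I\<close> also contains \<open>x\<close>, so
    maximality within \<open>C\<close> is maximality among all fixed intervals.\<close>
  have "maximal_fixed_interval_in S I"
    using I unfolding maximal_fixed_interval_in_def C_def by blast
  with I(1) that show thesis unfolding C_def by blast
qed

section \<open>Concatenations of words\<close>

text \<open>The word in \<open>symplectic_decomposition\<close>, isolated so that it can be treated
  by induction on \<open>k\<close>, growing at its right end.\<close>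

definition assemble :: "(nat \<Rightarrow> 'a list) \<Rightarrow> (nat \<Rightarrow> 'a list) \<Rightarrow> nat \<Rightarrow> 'a list" where
  "assemble X A k = X 0 @ concat (map (\<lambda>i. A i @ X i) [1..<Suc k])"

lemma assemble_0 [simp]: "assemble X A 0 = X 0"
  by (simp add: assemble_def)

lemma assemble_Suc [simp]: "assemble X A (Suc k) = assemble X A k @ A (Suc k) @ X (Suc k)"
  by (simp add: assemble_def)

lemma length_assemble: "length (assemble X A k) = prefix_length X A k"
  by (induction k) (simp_all add: prefix_length_def)

lemma assemble_cong:
  assumes "\<And>i. i \<le> k \<Longrightarrow> X i = X' i" "\<And>i. i \<in> {1..k} \<Longrightarrow> A i = A' i"
  shows "assemble X A k = assemble X' A' k"
  using assms by (induction k) simp_all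

lemma assemble_append_last:
  "assemble (X(k := X k @ ys)) A k = assemble X A k @ ys"
proof (cases k)
  case (Suc m)
  have "assemble (X(k := X k @ ys)) A m = assemble X A m"
    using Suc by (intro assemble_cong) auto
  then show ?thesis using Suc by simp
qed simp

lemma set_assemble: "set (assemble X A k) = (\<Union>i\<in>{0..k}. set (X i)) \<union> (\<Union>i\<in>{1..k}. set (A i))"
  by (induction k) (auto simp: atLeastAtMostSuc_conv atLeast0_atMost_Suc)

lemma assemble_split:
  assumes "i \<in> {1..k}"
  shows "\<exists>r. assemble X A k = assemble X A (i - 1) @ A i @ r"
  using assms
proof (induction k)
  case (Suc k)
  show ?case
  proof (cases "i = Suc k")
    case False
    then have "i \<in> {1..k}" using Suc.prems by auto
    then show ?thesis using Suc.IH by fastforce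
  qed simp
qed simp

text \<open>Identifies \<open>prefix_length X A (i - 1)\<close>, the number t^(i-1) of the theorem,
  as the zero-based index of the first letter of \<open>A i\<close>; this ties the inequalities to
  positions in the word.\<close>

lemma nth_assemble:
  assumes "i \<in> {1..k}" "j < length (A i)"
  shows "assemble X A k ! (prefix_length X A (i - 1) + j) = A i ! j"
    and "prefix_length X A (i - 1) + j < length (assemble X A k)"
proof -
  obtain r where r: "assemble X A k = assemble X A (i - 1) @ A i @ r"
    using assemble_split[OF assms(1)] by blast
  show "assemble X A k ! (prefix_length X A (i - 1) + j) = A i ! j"
    unfolding r length_assemble[symmetric] using assms(2) by (simp add: nth_append)
  show "prefix_length X A (i - 1) + j < length (assemble X A k)"
    unfolding r length_assemble[symmetric] using assms(2) by simp
qed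

lemma prefix_length_mono: "i \<le> j \<Longrightarrow> prefix_length X A i \<le> prefix_length X A j"
  unfolding prefix_length_def by (intro add_mono sum_mono2) auto

text \<open>The nonempty word \<open>A i\<close> is counted in \<open>prefix_length X A i\<close>
  but not in \<open>prefix_length X A (i - 1)\<close>, and \<open>i \<le> j - 1\<close>.\<close>

lemma prefix_length_less:
  assumes "1 \<le> i" "i < j" "A i \<noteq> []"
  shows "prefix_length X A (i - 1) < prefix_length X A (j - 1)"
proof -
  obtain m where m: "i = Suc m" using assms(1) by (cases i) auto
  have "prefix_length X A m < prefix_length X A i"
    using assms(3) unfolding m prefix_length_def by simp
  also have "\<dots> \<le> prefix_length X A (j - 1)" using assms(2) by (intro prefix_length_mono) simp
  finally show ?thesis by (simp add: m)
qed

section \<open>Decompositions at the maximal fixed intervals\<close>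

text \<open>All conditions on a decomposition except the inequalities. The ambient word \<open>a\<close> is kept
  apart from the assembled word so that proper prefixes of \<open>a\<close> can be decomposed by induction.\<close>

definition interval_decomposition ::
  "int list \<Rightarrow> int list \<Rightarrow> nat \<Rightarrow> (nat \<Rightarrow> int list) \<Rightarrow> (nat \<Rightarrow> int list) \<Rightarrow> bool" where
  "interval_decomposition a w k X A \<longleftrightarrow>
     w = assemble X A k \<and>
     (\<forall>i\<in>{0..k}. \<forall>x\<in>set (X i). parity_inv x \<notin> set a) \<and>
     (\<forall>i\<in>{1..k}. maximal_fixed_interval_in (set a) (set (A i)))"

lemma symplectic_imp_interval_decomposition:
  assumes "symplectic_decomposition n t a k X A"
  shows "interval_decomposition a a k X A"
  unfolding interval_decomposition_def
proof (intro conjI ballI)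
  have a: "a = X 0 @ concat (map (\<lambda>i. A i @ X i) [1..<Suc k])"
    and X: "parity_inv ` set (concat (map X [0..<Suc k])) \<inter> set a = {}"
    and A: "\<And>i. i \<in> {1..k} \<Longrightarrow> maximal_fixed_interval_in (set a) (set (A i))"
    using assms unfolding symplectic_decomposition_def by (blast, blast, blast)
  show "a = assemble X A k" using a unfolding assemble_def .
  show "parity_inv x \<notin> set a" if "i \<in> {0..k}" "x \<in> set (X i)" for i x
  proof -
    have "i \<in> set [0..<Suc k]" using that(1) by (simp del: upt_Suc)
    then have "x \<in> set (concat (map X [0..<Suc k]))"
      using that(2) unfolding set_concat set_map by blast
    then show ?thesis using X by blast
  qed
  show "maximal_fixed_interval_in (set a) (set (A i))" if "i \<in> {1..k}" for i
    using A that .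
qed

text \<open>The words \<open>A i\<close> hold only paired letters, the words \<open>X i\<close> only
  unpaired ones, and together they exhaust \<open>set a\<close>.\<close>

lemma interval_decomposition_Un:
  assumes "interval_decomposition a a k X A"
  shows "(\<Union>i\<in>{1..k}. set (A i)) = {x \<in> set a. parity_inv x \<in> set a}"
proof
  show "(\<Union>i\<in>{1..k}. set (A i)) \<subseteq> {x \<in> set a. parity_inv x \<in> set a}"
    using assms fixed_interval_paired
    unfolding interval_decomposition_def maximal_fixed_interval_in_def by fastforce
  have "set a = (\<Union>i\<in>{0..k}. set (X i)) \<union> (\<Union>i\<in>{1..k}. set (A i))"
    using assms set_assemble unfolding interval_decomposition_def by metis
  then show "{x \<in> set a. parity_inv x \<in> set a} \<subseteq> (\<Union>i\<in>{1..k}. set (A i))"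
    using assms unfolding interval_decomposition_def by blast
qed

text \<open>Filtering keeps every \<open>X i\<close> whole and deletes every \<open>A i\<close>. As
  a consequence the words \<open>X i\<close> inherit the strict order of a column
  \<open>a\<close>.\<close>

lemma interval_decomposition_filter:
  assumes "interval_decomposition a a k X A"
  shows "concat (map X [0..<Suc k]) = filter (\<lambda>x. parity_inv x \<notin> set a) a"
proof -
  have a: "assemble X A k = a"
    and X: "\<And>i. i \<le> k \<Longrightarrow> \<forall>x\<in>set (X i). parity_inv x \<notin> set a"
    using assms unfolding interval_decomposition_def by auto
  \<comment> \<open>The induction runs over prefixes, while the filter keeps referring to all of
    \<open>a\<close>.\<close>
  have "filter (\<lambda>x. parity_inv x \<notin> set a) (assemble X A m) = concat (map X [0..<Suc m])"
    if "m \<le> k" for m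
    using that
  proof (induction m)
    case 0
    have "filter (\<lambda>x. parity_inv x \<notin> set a) (X 0) = X 0"
      using X by (intro filter_True) blast
    then show ?case by simp
  next
    case (Suc m)
    have "Suc m \<in> {1..k}" using Suc.prems by simp
    then have "set (A (Suc m)) \<subseteq> {x \<in> set a. parity_inv x \<in> set a}"
      unfolding interval_decomposition_Un[OF assms, symmetric] by blast
    then have "filter (\<lambda>x. parity_inv x \<notin> set a) (A (Suc m)) = []"
      by (auto simp: filter_empty_conv)
    moreover have "filter (\<lambda>x. parity_inv x \<notin> set a) (X (Suc m)) = X (Suc m)"
      using Suc.prems X by (intro filter_True) blast
    ultimately show ?case using Suc by simp
  qed
  from this[of k] show ?thesis by (simp only: a)
qed

section \<open>The blocks \<open>A i\<close> inside a column, from left to right\<close>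

context
  fixes a :: "int list" and k :: nat and X A :: "nat \<Rightarrow> int list"
  assumes col: "column_word a" and dec: "interval_decomposition a a k X A"
begin

lemma block_nonempty:
  assumes "i \<in> {1..k}"
  shows "A i \<noteq> []"
proof -
  have "maximal_fixed_interval_in (set a) (set (A i))"
    using dec assms unfolding interval_decomposition_def by blast
  then show ?thesis by (simp add: maximal_fixed_interval_in_def fixed_interval_in_def)
qed

lemma block_nth:
  assumes "i \<in> {1..k}" "j < length (A i)"
  shows "a ! (prefix_length X A (i - 1) + j) = A i ! j"
    and "prefix_length X A (i - 1) + j < length a"
  using nth_assemble[where A=A and X=X, OF assms] dec unfolding interval_decomposition_def by simp_all

lemma hd_block:
  assumes "i \<in> {1..k}"
  shows "a ! prefix_length X A (i - 1) = hd (A i)" "prefix_length X A (i - 1) < length a"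
  using block_nth[OF assms, of 0] block_nonempty[OF assms] by (simp_all add: hd_conv_nth)

lemma hd_block_less:
  assumes "i \<in> {1..k}" "j \<in> {1..k}" "i < j"
  shows "hd (A i) < hd (A j)"
proof -
  have "prefix_length X A (i - 1) < prefix_length X A (j - 1)"
    using assms block_nonempty by (intro prefix_length_less) auto
  then have "a ! prefix_length X A (i - 1) < a ! prefix_length X A (j - 1)"
    using col hd_block(2)[OF assms(2)] unfolding column_word_def
    by (simp add: sorted_wrt_nth_less)
  then show ?thesis using assms hd_block by simp
qed

lemma block_column:
  assumes "i \<in> {1..k}"
  shows "column_word (A i)"
proof -
  obtain r where "a = assemble X A (i - 1) @ A i @ r"
    using assemble_split[OF assms, of X A] dec unfolding interval_decomposition_def by metis
  then show ?thesis using col unfolding column_word_def by (simp add: sorted_wrt_append)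
qed

text \<open>A strictly increasing word is determined by its set of letters, so the shape of a fixed
  interval carries over from the set to the word.\<close>

lemma block_upto:
  assumes "i \<in> {1..k}"
  obtains c u where "A i = [c..u]" "c < u" "odd c" "even u"
proof -
  have "fixed_interval_in (set a) (set (A i))"
    using dec assms unfolding interval_decomposition_def maximal_fixed_interval_in_def by blast
  then obtain c u where cu: "set (A i) = {c..u}" "c < u" "odd c" "even u"
    by (rule fixed_intervalE)
  have "A i = [c..u]"
    using block_column[OF assms] cu(1) unfolding column_word_def
    by (intro strict_sorted_equal) auto
  with cu that show thesis by blast
qed

text \<open>Maximality only shows that intersecting blocks are equal; that no block is listed twice
  follows from the strict increase of the first letters.\<close>

lemma blocks_disjoint:
  "disjoint_family_on (\<lambda>i. set (A i)) {1..k}"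
unfolding disjoint_family_on_def
proof (intro ballI impI, rule ccontr)
  fix i j
  assume ij: "i \<in> {1..k}" "j \<in> {1..k}" "i \<noteq> j" "set (A i) \<inter> set (A j) \<noteq> {}"
  then have "set (A i) = set (A j)"
    using dec maximal_fixed_interval_unique unfolding interval_decomposition_def by blast
  then have "A i = A j"
    using block_column ij unfolding column_word_def by (blast intro: strict_sorted_equal)
  then show False using ij hd_block_less[of i j] hd_block_less[of j i] by (auto simp: neq_iff)
qed

text \<open>The right-hand side depends on \<open>set a\<close> alone. Together with
  \<open>sorted_hd_blocks\<close> this makes the list of first letters an invariant of
  \<open>a\<close>.\<close>

lemma set_hd_blocks:
  "set (map (\<lambda>i. hd (A i)) [1..<Suc k]) = Min ` Collect (maximal_fixed_interval_in (set a))"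
proof -
  have hd_Min: "hd (A i) = Min (set (A i))" if "i \<in> {1..k}" for i
  proof -
    obtain c u where cu: "A i = [c..u]" "c < u" by (rule block_upto[OF \<open>i \<in> {1..k}\<close>])
    then have "hd (A i) = c" by (simp add: upto.simps)
    moreover have "Min (set (A i)) = c" using cu by (intro Min_eqI) auto
    ultimately show ?thesis by simp
  qed
  have "Collect (maximal_fixed_interval_in (set a)) = (\<lambda>i. set (A i)) ` {1..k}"
  proof
    show "(\<lambda>i. set (A i)) ` {1..k} \<subseteq> Collect (maximal_fixed_interval_in (set a))"
      using dec unfolding interval_decomposition_def by blast
    \<comment> \<open>A maximal fixed interval contains a paired letter, which lies in some block;
      the two maximal intervals meet and hence agree.\<close>
    show "Collect (maximal_fixed_interval_in (set a)) \<subseteq> (\<lambda>i. set (A i)) ` {1..k}"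
    proof
      fix I assume "I \<in> Collect (maximal_fixed_interval_in (set a))"
      then have I: "maximal_fixed_interval_in (set a) I" by simp
      then obtain x where x: "x \<in> I"
        unfolding maximal_fixed_interval_in_def fixed_interval_in_def by blast
      then have "x \<in> {x \<in> set a. parity_inv x \<in> set a}"
        using I fixed_interval_paired unfolding maximal_fixed_interval_in_def by blast
      then obtain i where i: "i \<in> {1..k}" "x \<in> set (A i)"
        using interval_decomposition_Un[OF dec] by blast
      then have "I = set (A i)"
        using I x dec maximal_fixed_interval_unique unfolding interval_decomposition_def by blast
      with i show "I \<in> (\<lambda>i. set (A i)) ` {1..k}" by blast
    qed
  qed
  then have "Min ` Collect (maximal_fixed_interval_in (set a)) = (\<lambda>i. hd (A i)) ` {1..k}"
    using hd_Min by (auto simp: image_image)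
  then show ?thesis by (simp only: set_map set_upt atLeastLessThanSuc_atLeastAtMost)
qed

lemma sorted_hd_blocks: "sorted_wrt (<) (map (\<lambda>i. hd (A i)) [1..<Suc k])"
  unfolding sorted_wrt_iff_nth_less
proof (intro allI impI)
  fix i j assume ij: "i < j" "j < length (map (\<lambda>i. hd (A i)) [1..<Suc k])"
  then show "map (\<lambda>i. hd (A i)) [1..<Suc k] ! i < map (\<lambda>i. hd (A i)) [1..<Suc k] ! j"
    using hd_block_less[of "Suc i" "Suc j"] by (simp del: upt_Suc)
qed

end

text \<open>Both lists of first letters are strictly increasing with the same set, hence equal.
  Their length gives \<open>k\<close>, and blocks with a common first letter are the same maximal
  interval.\<close>

lemma interval_decomposition_unique:
  assumes col: "column_word a"
    and d: "interval_decomposition a a k X A" and d': "interval_decomposition a a k' X' A'"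
  shows "k = k'" and "\<forall>i\<in>{1..k}. A i = A' i"
proof -
  have eq: "map (\<lambda>i. hd (A i)) [1..<Suc k] = map (\<lambda>i. hd (A' i)) [1..<Suc k']"
    using sorted_hd_blocks[OF col d] sorted_hd_blocks[OF col d']
      set_hd_blocks[OF col d] set_hd_blocks[OF col d']
    by (intro strict_sorted_equal) simp_all
  then show k: "k = k'" by (metis length_map length_upt diff_Suc_1)
  show "\<forall>i\<in>{1..k}. A i = A' i"
  proof
    fix i assume i: "i \<in> {1..k}"
    then have i': "i \<in> {1..k'}" by (simp add: k)
    have "hd (A i) = hd (A' i)" using eq i k by (simp del: upt_Suc)
    moreover have "hd (A i) \<in> set (A i)" "hd (A' i) \<in> set (A' i)"
      using block_nonempty[OF col d i] block_nonempty[OF col d' i'] by simp_all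
    ultimately have "set (A i) = set (A' i)"
      using d d' i i' maximal_fixed_interval_unique[of "set a" "set (A i)" "set (A' i)"]
      unfolding interval_decomposition_def by metis
    then show "A i = A' i"
      using block_column[OF col d i] block_column[OF col d' i'] unfolding column_word_def
      by (intro strict_sorted_equal)
  qed
qed

text \<open>Induction on the length of \<open>w\<close>, removing its last letter if that is
  unpaired and otherwise the whole maximal interval at its end. The last hypothesis says that the
  end of \<open>w\<close> cuts through no maximal fixed interval of \<open>a\<close>; it survives
  both removals.\<close>

lemma interval_decomposition_prefix_exists:
  assumes "column_word a" "a = w @ r"
    and "\<And>I. maximal_fixed_interval_in (set a) I \<Longrightarrow> I \<subseteq> set w \<or> I \<inter> set w = {}"
  shows "\<exists>k X A. interval_decomposition a w k X A"
  using assms(2,3)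
proof (induction "length w" arbitrary: w r rule: less_induct)
  case less
  have col_w: "sorted_wrt (<) w"
    using assms(1) less.prems(1) unfolding column_word_def by (simp add: sorted_wrt_append)
  show ?case
  proof (cases w rule: rev_cases)
    case Nil
    then have "interval_decomposition a w 0 (\<lambda>_. []) (\<lambda>_. [])"
      unfolding interval_decomposition_def by simp
    then show ?thesis by blast
  next
    case (snoc v x)
    have v_less: "\<forall>y\<in>set v. y < x" using col_w snoc by (simp add: sorted_wrt_append)
    have xa: "x \<in> set a" using less.prems(1) snoc by simp
    show ?thesis
    proof (cases "parity_inv x \<in> set a")
      case False
      have "I \<subseteq> set v \<or> I \<inter> set v = {}" if I: "maximal_fixed_interval_in (set a) I" for I
      proof -
        have "x \<notin> I"
          using I False fixed_interval_paired unfolding maximal_fixed_interval_in_def by blast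
        then show ?thesis using less.prems(2)[OF I] snoc by auto
      qed
      then obtain k X A where d: "interval_decomposition a v k X A"
        using less.hyps[of v "x # r"] less.prems(1) snoc by auto
      have "interval_decomposition a w k (X(k := X k @ [x])) A"
        using d False snoc unfolding interval_decomposition_def
        by (auto simp: assemble_append_last)
      then show ?thesis by blast
    next
      case True
      obtain I where I: "maximal_fixed_interval_in (set a) I" "x \<in> I"
        using paired_in_maximal_fixed_interval[OF finite_set xa True] .
      then have Iw: "I \<subseteq> set w" using less.prems(2) snoc by auto
      obtain l u where lu: "I = {l..u}"
        using I(1) unfolding maximal_fixed_interval_in_def fixed_interval_in_def by blast
      \<comment> \<open>The interval lies inside \<open>w\<close> and contains the last letter of
        \<open>w\<close>, so it ends there.\<close>
      have "x = u"
      proof -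
        have "u \<in> set w" using Iw I(2) lu by auto
        then have "u \<le> x" using v_less snoc by auto
        then show ?thesis using I(2) lu by simp
      qed
      define v' where "v' = filter (\<lambda>y. y < l) w"
      have w: "w = v' @ [l..x]"
      proof (rule strict_sorted_equal[OF col_w, symmetric])
        show "sorted_wrt (<) (v' @ [l..x])"
          using col_w by (auto simp: v'_def sorted_wrt_append sorted_wrt_filter)
        show "set (v' @ [l..x]) = set w"
          using Iw lu \<open>x = u\<close> v_less snoc by (auto simp: v'_def not_less)
      qed
      have "J \<subseteq> set v' \<or> J \<inter> set v' = {}" if J: "maximal_fixed_interval_in (set a) J" for J
      proof (cases "J = I")
        case True
        then show ?thesis using lu by (auto simp: v'_def)
      next
        case False
        \<comment> \<open>Distinct maximal intervals are disjoint, so removing all of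
          \<open>I\<close> cuts none of the others.\<close>
        then have "J \<inter> I = {}" using maximal_fixed_interval_unique I(1) J by blast
        then show ?thesis using less.prems(2)[OF J] lu \<open>x = u\<close> unfolding w by auto
      qed
      moreover have "length v' < length w" using w I(2) lu by (simp add: \<open>x = u\<close>)
      ultimately obtain k X A where d: "interval_decomposition a v' k X A"
        using less.hyps[of v' "[l..x] @ r"] less.prems(1) w by auto
      \<comment> \<open>The new block is followed by an empty word, to which unpaired letters
        further to the right can be appended at longer prefixes.\<close>
      let ?X = "X(Suc k := [])" and ?A = "A(Suc k := [l..x])"
      have "assemble ?X ?A k = assemble X A k" by (intro assemble_cong) auto
      then have "interval_decomposition a w (Suc k) ?X ?A"
        using d w I(1) lu \<open>x = u\<close> unfolding interval_decomposition_def
        by (auto simp: le_Suc_eq)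
      then show ?thesis by blast
    qed
  qed
qed

lemma interval_decomposition_exists:
  assumes "column_word a"
  shows "\<exists>k X A. interval_decomposition a a k X A"
proof (rule interval_decomposition_prefix_exists[OF assms])
  show "a = a @ []" by simp
  show "I \<subseteq> set a \<or> I \<inter> set a = {}" if "maximal_fixed_interval_in (set a) I" for I
    using that by (simp add: maximal_fixed_interval_in_def fixed_interval_in_def)
qed

section \<open>The symplectic condition\<close>

text \<open>The substitution \<open>k = p + 1\<close> turns the bound into \<open>2 * p + 1\<close>
  at list index \<open>p\<close>.\<close>

lemma SpT_iff_nth:
  "a \<in> SpT n t \<longleftrightarrow> a \<in> SST n t \<and> (\<forall>p<t. a ! p \<ge> 2 * int p + 1)"
proof -
  have "(\<forall>k\<in>{1..t}. a ! (k - 1) \<ge> 2 * int k - 1) \<longleftrightarrow> (\<forall>p<t. a ! p \<ge> 2 * int p + 1)"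
  proof safe
    fix p assume "\<forall>k\<in>{1..t}. 2 * int k - 1 \<le> a ! (k - 1)" "p < t"
    then show "2 * int p + 1 \<le> a ! p" by (auto dest: bspec[of _ _ "Suc p"])
  next
    fix k assume "\<forall>p<t. 2 * int p + 1 \<le> a ! p" "k \<in> {1..t}"
    then show "2 * int k - 1 \<le> a ! (k - 1)" by (auto dest: spec[of _ "k - 1"] simp: of_nat_diff)
  qed
  then show ?thesis unfolding SpT_def by blast
qed

lemma SpT_imp_symplectic_decomposition:
  assumes "t \<ge> 1" "a \<in> SpT n t"
  shows "\<exists>k X A. symplectic_decomposition n t a k X A"
proof -
  have len: "length a = t" and col: "column_word a" and sub: "set a \<subseteq> {1..2 * int n}"
    and sp: "\<And>p. p < t \<Longrightarrow> a ! p \<ge> 2 * int p + 1"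
    using assms(2) unfolding SpT_iff_nth SST_def by auto
  obtain k X A where d: "interval_decomposition a a k X A"
    using interval_decomposition_exists[OF col] by blast
  have a: "a = assemble X A k" using d unfolding interval_decomposition_def by blast
  \<comment> \<open>The last entry is at least \<open>2 * t - 1\<close> and at most
    \<open>2 * n\<close>, which over the integers gives \<open>t \<le> n\<close>.\<close>
  have "t \<in> {1..n}"
  proof -
    have "a ! (t - 1) \<in> set a" using assms(1) len by simp
    then have "a ! (t - 1) \<le> 2 * int n" using sub by fastforce
    then show ?thesis using sp[of "t - 1"] assms(1) by simp
  qed
  \<comment> \<open>Each \<open>X i\<close> is a factor of the concatenation of all of them, which
    is a subword of \<open>a\<close> obtained by filtering.\<close>
  moreover have "column_word (X i)" if "i \<in> {0..k}" for i
  proof -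
    have "column_word (concat (map X [0..<Suc k]))"
      using interval_decomposition_filter[OF d] col unfolding column_word_def
      by (simp add: sorted_wrt_filter)
    moreover have "[0..<Suc k] = [0..<i] @ i # [Suc i..<Suc k]"
      using that by (metis atLeastAtMost_iff le_imp_less_Suc upt_conv_Cons upt_add_eq_append
        le_add_diff_inverse less_imp_le zero_le)
    ultimately show ?thesis unfolding column_word_def by (simp add: sorted_wrt_append del: upt_Suc)
  qed
  moreover have "parity_inv ` set (concat (map X [0..<Suc k])) \<inter> set a = {}"
    unfolding interval_decomposition_filter[OF d] by auto
  moreover have "\<exists>c l. length (A i) = l \<and> odd c \<and> even l \<and> l \<ge> 2 \<and> A i = [c..c + int l - 1] \<and>
        maximal_fixed_interval_in (set a) (set (A i)) \<and>
        c \<ge> 2 * int (prefix_length X A (i - 1)) + int l + 1" if i: "i \<in> {1..k}" for i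
  proof -
    obtain c u where cu: "A i = [c..u]" "c < u" "odd c" "even u"
      by (rule block_upto[OF col d i])
    define l where "l = length (A i)"
    have l: "int l = u - c + 1" using cu(1,2) by (simp add: l_def)
    then have u: "u = c + int l - 1" by simp
    have "even (int l)" using cu(3,4) unfolding l by simp
    then have el: "even l" by simp
    have l2: "l \<ge> 2" using l cu(2) by linarith
    let ?T = "prefix_length X A (i - 1)"
    have "l - 1 < length (A i)" using l2 l_def by simp
    then have "a ! (?T + (l - 1)) = u" "?T + (l - 1) < t"
      using block_nth[OF col d i, of "l - 1"] len cu(1) l l2 by (simp_all add: of_nat_diff)
    then have "u \<ge> 2 * int (?T + (l - 1)) + 1" using sp by metis
    \<comment> \<open>The last letter \<open>c + l - 1\<close> of the block has zero-based index
      \<open>?T + l - 1\<close>, so it is at least \<open>2 * (?T + l) - 1\<close>. Equality in the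
      resulting bound is impossible because \<open>c\<close> is odd and \<open>l\<close> is
      even.\<close>
    then have "c \<ge> 2 * int ?T + int l" using u l2 by (simp add: of_nat_diff)
    moreover have "c \<noteq> 2 * int ?T + int l" using cu(3) el by auto
    ultimately have "c \<ge> 2 * int ?T + int l + 1" by simp
    moreover have "maximal_fixed_interval_in (set a) (set (A i))"
      using d i unfolding interval_decomposition_def by blast
    ultimately show ?thesis using cu(1,3) u el l2 l_def by blast
  qed
  moreover have "t = prefix_length X A k" using len a length_assemble by metis
  moreover have "a = X 0 @ concat (map (\<lambda>i. A i @ X i) [1..<Suc k])"
    using a unfolding assemble_def .
  ultimately show ?thesis unfolding symplectic_decomposition_def by blast
qed

lemma symplectic_decomposition_imp_SpT:
  assumes SST: "a \<in> SST n t" and sd: "symplectic_decomposition n t a k X A"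
  shows "a \<in> SpT n t"
proof -
  have len: "length a = t" and col: "column_word a" and pos: "\<forall>x\<in>set a. 1 \<le> x"
    using SST unfolding SST_def by auto
  note d = symplectic_imp_interval_decomposition[OF sd]
  have "2 * int p + 1 \<le> a ! p" if "p < t" for p
    using that
  proof (induction p)
    case 0
    then show ?case using pos len by simp
  next
    case (Suc p)
    let ?x = "a ! Suc p"
    have xa: "?x \<in> set a" and ya: "a ! p \<in> set a" using Suc.prems len by simp_all
    show ?case
    proof (cases "parity_inv ?x \<in> set a")
      \<comment> \<open>For a paired letter the induction hypothesis is not called on: its index is
        \<open>prefix_length X A (i - 1) + j\<close> with \<open>j < l\<close>, and the bound on
        \<open>c\<close> suffices.\<close>
      case True
      then obtain i where i: "i \<in> {1..k}" "?x \<in> set (A i)"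
        using interval_decomposition_Un[OF d] xa by blast
      obtain c l where cl: "length (A i) = l" "A i = [c..c + int l - 1]"
        "c \<ge> 2 * int (prefix_length X A (i - 1)) + int l + 1"
        using sd i(1) unfolding symplectic_decomposition_def by blast
      obtain j where j: "j < l" "A i ! j = ?x" using i(2) cl(1) by (metis in_set_conv_nth)
      have "a ! (prefix_length X A (i - 1) + j) = ?x" "prefix_length X A (i - 1) + j < length a"
        using block_nth[OF col d i(1), of j] j cl(1) by simp_all
      then have "Suc p = prefix_length X A (i - 1) + j"
        using col Suc.prems len unfolding column_word_def
        by (metis nth_eq_iff_index_eq strict_sorted_iff)
      then have "2 * int (Suc p) + 1 = 2 * int (prefix_length X A (i - 1)) + 2 * int j + 1" by simp
      also have "\<dots> \<le> 2 * int (prefix_length X A (i - 1)) + int l + 1 + int j"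
        using j(1) by simp
      also have "\<dots> \<le> c + int j" using cl(3) by simp
      also have "\<dots> = ?x" using j cl(2) by simp
      finally show ?thesis .
    next
      case False
      have less: "a ! p < ?x"
        using col Suc.prems len unfolding column_word_def by (simp add: sorted_wrt_nth_less)
      have IH: "2 * int p + 1 \<le> a ! p" using Suc by simp
      \<comment> \<open>Strict increase and the induction hypothesis give only
        \<open>?x \<ge> 2 * p + 2\<close>, one short of the goal. Equality would squeeze
        \<open>a ! p\<close> to \<open>2 * p + 1\<close>, the partner of \<open>?x\<close>.\<close>
      have "?x \<noteq> 2 * int p + 2"
      proof
        assume "?x = 2 * int p + 2"
        moreover from this have "a ! p = 2 * int p + 1" using less IH by simp
        ultimately have "parity_inv ?x = a ! p" by (simp add: parity_inv_def)
        then show False using False ya by simp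
      qed
      then show ?thesis using less IH by simp
    qed
  qed
  then show ?thesis using SST by (simp add: SpT_iff_nth)
qed

text \<open>Blocks are compared only on \<open>{1..k}\<close>, since the families take arbitrary
  values elsewhere. The remaining subword is given as a list, the concatenation of the words
  \<open>X i\<close>, so that its order is recorded as well.\<close>

theorem theorem1:
  fixes n t :: nat and a :: "int list"
  assumes "n \<ge> 1" and "t \<ge> 1" and "a \<in> SST n t"
  shows "(a \<in> SpT n t \<longleftrightarrow> (\<exists>k X A. symplectic_decomposition n t a k X A)) \<and>
    (\<forall>k X A k' X' A'.
       symplectic_decomposition n t a k X A \<and> symplectic_decomposition n t a k' X' A' \<longrightarrow>
         k = k' \<and> (\<forall>i\<in>{1..k}. A i = A' i)) \<and>
    (\<forall>k X A. symplectic_decomposition n t a k X A \<longrightarrow>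
       disjoint_family_on (\<lambda>i. set (A i)) {1..k} \<and>
       (\<Union>i\<in>{1..k}. set (A i)) = {x \<in> set a. parity_inv x \<in> set a} \<and>
       concat (map X [0..<Suc k]) = filter (\<lambda>x. x \<notin> (\<Union>i\<in>{1..k}. set (A i))) a \<and>
       parity_inv ` (set a - (\<Union>i\<in>{1..k}. set (A i))) \<inter> set a = {})"
proof (intro conjI allI impI)
  have col: "column_word a" using assms(3) unfolding SST_def by blast
  show "a \<in> SpT n t \<longleftrightarrow> (\<exists>k X A. symplectic_decomposition n t a k X A)"
    using SpT_imp_symplectic_decomposition symplectic_decomposition_imp_SpT assms by blast
  fix k X A
  {
    fix k' X' A'
    assume "symplectic_decomposition n t a k X A \<and> symplectic_decomposition n t a k' X' A'"
    then show "k = k'" "\<forall>i\<in>{1..k}. A i = A' i"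
      using interval_decomposition_unique[OF col] symplectic_imp_interval_decomposition by blast+
  next
    assume "symplectic_decomposition n t a k X A"
    then have d: "interval_decomposition a a k X A"
      by (rule symplectic_imp_interval_decomposition)
    note Un = interval_decomposition_Un[OF d]
    show "disjoint_family_on (\<lambda>i. set (A i)) {1..k}" by (rule blocks_disjoint[OF col d])
    show "(\<Union>i\<in>{1..k}. set (A i)) = {x \<in> set a. parity_inv x \<in> set a}" by (rule Un)
    show "concat (map X [0..<Suc k]) = filter (\<lambda>x. x \<notin> (\<Union>i\<in>{1..k}. set (A i))) a"
      unfolding interval_decomposition_filter[OF d] Un by (rule filter_cong) auto
    show "parity_inv ` (set a - (\<Union>i\<in>{1..k}. set (A i))) \<inter> set a = {}"
      unfolding Un by auto
  }
qed

end
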